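(* Let $\Omega\subset\mathbb{R}$ be a domain subdivided into two subdomains $\Omega^+$ and $\Omega^-$ separated by an interface $\Gamma$, across which a function $A(x)$ (equal to $A^+$ in $\Omega^+$ and $A^-$ in $\Omega^-$) is allowed to be discontinuous. Assume that $A^+$ and $A^-$ admit sufficiently smooth extensions, still denoted $A^+(x)$ and $A^-(x)$, across the interface, and let $D(x)=A^+(x)-A^-(x)$ be the correction function. Assume that the approximation $D_{k+1/2}$ of $D$ at the nodes $x_{k+1/2}$ is $p$-order accurate, i.e. $D(x_{k+1/2})=D_{k+1/2}+\mathcal{O}(\Delta x^p)$. Consider the fourth-order centered finite difference scheme $$\partial_x A_i=\frac{A_{i-3/2}-27\,A_{i-1/2}+27\,A_{i+1/2}-A_{i+3/2}}{24\,\Delta x}.$$ Then, when a correction is applied (that is, when the stencil involves nodes in both subdomains and the values at nodes not in the subdomain of $x_i$ are corrected with the approximate correction function), the order of the scheme is $q=\min\{p-1,4\}$: if $x_i\in\Omega^{\circ}$ with $\circ\in\{+,-\}$ and $\partial_xA_i^{\circ}$ denotes the corrected finite difference value, then $$\partial_xA_i^{\circ}=\partial_xA^{\circ}(x_i)+\mathcal{O}(\Delta x^{q}),\qquad q=\min\{p-1,4\}.$$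
   Context: Uniform staggered grid with step $\Delta x$: $x_{k+1/2}$ are the nodes, spaced by $\Delta x$, and $x_i$ is the midpoint of $[x_{i-1/2},x_{i+1/2}]$. $A_{k+1/2}$ denotes the value of $A$ at $x_{k+1/2}$: it is $A^+(x_{k+1/2})$ if $x_{k+1/2}\in\Omega^+$ and $A^-(x_{k+1/2})$ if $x_{k+1/2}\in\Omega^-$. Corrected scheme at $x_i$: if $x_i\in\Omega^+$, then in the finite difference formula every value $A_{k+1/2}$ at a stencil node $x_{k+1/2}\in\Omega^-$ is replaced by $A^-_{k+1/2}+D_{k+1/2}$, and values at nodes in $\Omega^+$ are unchanged; if $x_i\in\Omega^-$, every value at a stencil node in $\Omega^+$ is replaced by $A^+_{k+1/2}-D_{k+1/2}$, and values at nodes in $\Omega^-$ are unchanged. "Order $q$" refers to the truncation error of the approximation of the first derivative being $\mathcal{O}(\Delta x^q)$ as $\Delta x\to 0$. *)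

theory Defs
  imports "HOL-Analysis.Analysis"
begin

text \<open>The two pieces are only required to be open, not connected, so an interface consisting of
  several points is allowed. If both pieces are connected, then \<open>\<Gamma>\<close> is a single point and the
  compactness condition is automatic.\<close>

definition interface_subdivision ::
    "real set \<Rightarrow> real set \<Rightarrow> real set \<Rightarrow> real set \<Rightarrow> bool" where
  "interface_subdivision \<Omega> \<Omega>p \<Omega>m \<Gamma> \<longleftrightarrow>
     open \<Omega> \<and> connected \<Omega> \<and>
     open \<Omega>p \<and> \<Omega>p \<noteq> {} \<and> open \<Omega>m \<and> \<Omega>m \<noteq> {} \<and> \<Omega>p \<inter> \<Omega>m = {} \<and>
     \<Omega> = \<Omega>p \<union> \<Gamma> \<union> \<Omega>m \<and>
     \<Gamma> = \<Omega> \<inter> frontier \<Omega>p \<and> \<Gamma> = \<Omega> \<inter> frontier \<Omega>m \<and> compact \<Gamma>"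

definition Ck_on :: "nat \<Rightarrow> (real \<Rightarrow> real) \<Rightarrow> real set \<Rightarrow> bool" where
  "Ck_on k f U \<longleftrightarrow>
     open U \<and> (\<forall>j<k. (deriv ^^ j) f differentiable_on U) \<and> continuous_on U ((deriv ^^ k) f)"

definition correction_function :: "(real \<Rightarrow> real) \<Rightarrow> (real \<Rightarrow> real) \<Rightarrow> real \<Rightarrow> real" where
  "correction_function Ap Am x = Ap x - Am x"

text \<open>In \<open>node c h k\<close>, which is the grid point $x_{k+1/2}$, the integer \<open>k\<close> stands for the
  half-integer index $k + 1/2$; \<open>h\<close> is the step and \<open>c\<close> is the position of $x_{1/2}$. Thus
  $x_{i-3/2}, x_{i-1/2}, x_{i+1/2}, x_{i+3/2}$ have the indices \<open>i - 2\<close>, \<open>i - 1\<close>, \<open>i\<close>, \<open>i + 1\<close>.\<close>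

definition node :: "real \<Rightarrow> real \<Rightarrow> int \<Rightarrow> real" where
  "node c h k = c + of_int k * h"

definition cell_center :: "real \<Rightarrow> real \<Rightarrow> int \<Rightarrow> real" where
  "cell_center c h i = midpoint (node c h (i - 1)) (node c h i)"

definition stencil :: "int \<Rightarrow> int set" where
  "stencil i = {i - 2, i - 1, i, i + 1}"

definition fd4 :: "real \<Rightarrow> (int \<Rightarrow> real) \<Rightarrow> int \<Rightarrow> real" where
  "fd4 h v i = (v (i - 2) - 27 * v (i - 1) + 27 * v i - v (i + 1)) / (24 * h)"

text \<open>The value used at node \<open>k\<close> by the scheme at the center \<open>i\<close>; \<open>d k\<close> is the approximate
  correction at node \<open>k\<close>.\<close>

definition corrected_value ::
    "real set \<Rightarrow> real set \<Rightarrow> (real \<Rightarrow> real) \<Rightarrow> real \<Rightarrow> real \<Rightarrow> (int \<Rightarrow> real) \<Rightarrow> int \<Rightarrow> int \<Rightarrow> real" where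
  "corrected_value \<Omega>p \<Omega>m A c h d i k =
     (if cell_center c h i \<in> \<Omega>p \<and> node c h k \<in> \<Omega>m then A (node c h k) + d k
      else if cell_center c h i \<in> \<Omega>m \<and> node c h k \<in> \<Omega>p then A (node c h k) - d k
      else A (node c h k))"

definition corrected_fd4 ::
    "real set \<Rightarrow> real set \<Rightarrow> (real \<Rightarrow> real) \<Rightarrow> real \<Rightarrow> real \<Rightarrow> (int \<Rightarrow> real) \<Rightarrow> int \<Rightarrow> real" where
  "corrected_fd4 \<Omega>p \<Omega>m A c h d i = fd4 h (corrected_value \<Omega>p \<Omega>m A c h d i) i"

text \<open>The function \<open>A\<close> has no prescribed value on the interface, so no stencil node may lie
  on it.\<close>

definition cut_stencil :: "real set \<Rightarrow> real set \<Rightarrow> real \<Rightarrow> real \<Rightarrow> int \<Rightarrow> bool" where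
  "cut_stencil \<Omega>p \<Omega>m c h i \<longleftrightarrow>
     (\<forall>k\<in>stencil i. node c h k \<in> \<Omega>p \<union> \<Omega>m) \<and>
     (\<exists>k\<in>stencil i. node c h k \<in> \<Omega>p) \<and> (\<exists>k\<in>stencil i. node c h k \<in> \<Omega>m)"

text \<open>The nodes at which the scheme uses an approximate correction. For small \<open>h\<close> they are close
  to the interface, where both extensions, and hence the correction function, are defined.\<close>

definition correction_node :: "real set \<Rightarrow> real set \<Rightarrow> real \<Rightarrow> real \<Rightarrow> int \<Rightarrow> bool" where
  "correction_node \<Omega>p \<Omega>m c h k \<longleftrightarrow>
     (\<exists>i. cut_stencil \<Omega>p \<Omega>m c h i \<and> k \<in> stencil i \<and>
        (cell_center c h i \<in> \<Omega>p \<and> node c h k \<in> \<Omega>m \<or>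
         cell_center c h i \<in> \<Omega>m \<and> node c h k \<in> \<Omega>p))"

text \<open>As \<open>h\<close> tends to 0, \<open>e h j\<close> is $\mathcal{O}(g(h))$ uniformly in the indices \<open>j\<close> that satisfy
  \<open>P h j\<close>. Uniformity is essential: for a fixed point off the interface the stencil does not
  meet the interface once \<open>h\<close> is small.\<close>

definition uniform_bigo ::
    "(real \<Rightarrow> 'j \<Rightarrow> bool) \<Rightarrow> (real \<Rightarrow> 'j \<Rightarrow> real) \<Rightarrow> (real \<Rightarrow> real) \<Rightarrow> bool" where
  "uniform_bigo P e g \<longleftrightarrow>
     (\<exists>C. \<forall>\<^sub>F h in at_right 0. \<forall>j. P h j \<longrightarrow> \<bar>e h j\<bar> \<le> C * \<bar>g h\<bar>)"

end

theory Submission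
  imports Defs
begin

text \<open>A cut stencil has nodes on both sides, and \<open>\<Omega>\<close> is an interval, so there is an
  interface point within \<open>3h\<close> of all its points. As the interface is compact, for small
  \<open>h\<close> all cut stencils lie in one compact set on which both extensions are smooth, and Taylor
  expansion at the cell center bounds the error of the scheme for the extension by
  $\mathcal{O}(h^4)$ uniformly. On the side of the center, the scheme differs from the scheme for the
  extension only through the errors of the corrections, and the division by \<open>h\<close> turns
  $\mathcal{O}(h^p)$ into $\mathcal{O}(h^{p-1})$. The other side follows by exchanging the subdomains
  and the sign of the correction.\<close>

section \<open>The scheme on smooth functions: consistency and stability\<close>

lemma cell_center_eq: "cell_center c h i = node c h i - h / 2"
  by (simp add: cell_center_def node_def midpoint_def algebra_simps)

text \<open>\<open>Ck_on\<close> speaks of differentiability within \<open>U\<close>; openness of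
  \<open>U\<close> turns this into the two-sided derivatives that \<open>Taylor\<close> asks
  for.\<close>

lemma Ck_on_has_derivative:
  assumes "Ck_on k f U" "j < k" "x \<in> U"
  shows "((deriv ^^ j) f has_real_derivative (deriv ^^ Suc j) f x) (at x)"
proof -
  have "(deriv ^^ j) f differentiable at x"
    using assms unfolding Ck_on_def by (metis at_within_open differentiable_on_def)
  then show ?thesis
    by (metis DERIV_deriv_iff_real_differentiable comp_apply funpow.simps(2))
qed

lemma taylor5:
  fixes f :: "real \<Rightarrow> real"
  assumes smooth: "Ck_on 5 f U" and sub: "cball y r \<subseteq> U"
    and bound: "\<And>t. t \<in> cball y r \<Longrightarrow> \<bar>(deriv ^^ 5) f t\<bar> \<le> M" and s: "\<bar>s\<bar> \<le> r"
  shows "\<bar>f (y + s) - (\<Sum>m<5. (deriv ^^ m) f y / fact m * s ^ m)\<bar> \<le> M * \<bar>s\<bar> ^ 5 / 120"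
\<comment> \<open>\<open>Taylor\<close> needs an evaluation point different from the expansion
  point. At s = 0 only the term m = 0 of the sum survives, since 0 ^ 0 = 1.\<close>
proof (cases "s = 0")
  case True
  then show ?thesis by (simp add: numeral_eq_Suc)
next
  case False
  have "\<exists>t. (if y + s < y then y + s < t \<and> t < y else y < t \<and> t < y + s) \<and>
      f (y + s) = (\<Sum>m<5. (deriv ^^ m) f y / fact m * (y + s - y) ^ m) +
        (deriv ^^ 5) f t / fact 5 * (y + s - y) ^ 5"
  proof (rule Taylor[where a = "y - r" and b = "y + r"])
    show "\<forall>m t. m < 5 \<and> y - r \<le> t \<and> t \<le> y + r \<longrightarrow>
        ((deriv ^^ m) f has_real_derivative (deriv ^^ Suc m) f t) (at t)"
      using sub Ck_on_has_derivative[OF smooth]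
      by (simp add: cball_eq_atLeastAtMost subset_iff del: funpow.simps)
  qed (use s False in auto)
  then obtain t where t: "if y + s < y then y + s < t \<and> t < y else y < t \<and> t < y + s"
    and ft: "f (y + s) = (\<Sum>m<5. (deriv ^^ m) f y / fact m * s ^ m) + (deriv ^^ 5) f t / fact 5 * s ^ 5"
    by auto
  have "t \<in> cball y r"
    using t s by (auto simp: cball_eq_atLeastAtMost split: if_splits)
  then have "\<bar>(deriv ^^ 5) f t\<bar> * \<bar>s\<bar> ^ 5 \<le> M * \<bar>s\<bar> ^ 5"
    by (intro mult_right_mono bound) auto
  then show ?thesis
    unfolding ft by (simp add: abs_mult power_abs fact_numeral)
qed

lemma fd4_consistency:
  fixes f :: "real \<Rightarrow> real"
  assumes h: "0 < h" and smooth: "Ck_on 5 f U"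
    and sub: "cball (cell_center c h i) (3 * h / 2) \<subseteq> U"
    and bound: "\<And>t. t \<in> cball (cell_center c h i) (3 * h / 2) \<Longrightarrow> \<bar>(deriv ^^ 5) f t\<bar> \<le> M"
  shows "\<bar>fd4 h (\<lambda>k. f (node c h k)) i - deriv f (cell_center c h i)\<bar> \<le> M * h ^ 4"
proof -
  define y where "y = cell_center c h i"
  define T where "T s = (\<Sum>m<5. (deriv ^^ m) f y / fact m * s ^ m)" for s
  define R where "R s = f (y + s) - T s" for s
  have nodes: "node c h (i - 2) = y + (- 3 * h / 2)" "node c h (i - 1) = y + (- h / 2)"
    "node c h i = y + h / 2" "node c h (i + 1) = y + 3 * h / 2"
    by (simp_all add: y_def cell_center_eq node_def algebra_simps)
  have M: "0 \<le> M"
    using bound[of "cell_center c h i"] h by force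
  have R: "\<bar>R s\<bar> \<le> M * \<bar>s\<bar> ^ 5 / 120" if "\<bar>s\<bar> \<le> 3 * h / 2" for s
    unfolding R_def T_def
    using that by (intro taylor5[OF smooth sub bound, folded y_def]) auto
  \<comment> \<open>One bound serves all four nodes: the outer ones are the worst, with (3/2)^5 /
    120 = 243/3840 < 1/15. The weights 1, 27, 27, 1 then give 56/15 < 24.\<close>
  have "\<bar>R (- 3 * h / 2)\<bar> \<le> M * h ^ 5 / 15" "\<bar>R (- h / 2)\<bar> \<le> M * h ^ 5 / 15"
    "\<bar>R (h / 2)\<bar> \<le> M * h ^ 5 / 15" "\<bar>R (3 * h / 2)\<bar> \<le> M * h ^ 5 / 15"
    using R[of "- 3 * h / 2"] R[of "- h / 2"] R[of "h / 2"] R[of "3 * h / 2"] h M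
      mult_nonneg_nonneg[OF M, of "h ^ 5"]
    by (auto simp: power_divide power_mult_distrib)
  then have "\<bar>R (- 3 * h / 2) - 27 * R (- h / 2) + 27 * R (h / 2) - R (3 * h / 2)\<bar>
      \<le> 24 * (M * h ^ 5)"
    using mult_nonneg_nonneg[OF M, of "h ^ 5"] h by auto
  \<comment> \<open>The weights are antisymmetric about the center, so even powers cancel. The cubic
    terms cancel because 27 * (1/2)^3 = (3/2)^3, and the linear ones give 27h - 3h = 24h.\<close>
  moreover have "T (- 3 * h / 2) - 27 * T (- h / 2) + 27 * T (h / 2) - T (3 * h / 2)
      = 24 * h * deriv f y"
    by (simp add: T_def numeral_eq_Suc field_simps)
  then have "fd4 h (\<lambda>k. f (node c h k)) i - deriv f y
      = (R (- 3 * h / 2) - 27 * R (- h / 2) + 27 * R (h / 2) - R (3 * h / 2)) / (24 * h)"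
    unfolding fd4_def nodes R_def using h by (simp add: field_simps)
  ultimately have "\<bar>fd4 h (\<lambda>k. f (node c h k)) i - deriv f y\<bar> \<le> 24 * (M * h ^ 5) / (24 * h)"
    using h divide_right_mono[of _ "24 * (M * h ^ 5)" "24 * h"] by (simp only: abs_divide) simp
  also have "\<dots> = M * h ^ 4"
    using h by (simp add: power_eq_if)
  finally show ?thesis
    by (simp add: y_def)
qed

lemma fd4_perturbation:
  assumes h: "0 < h" and vw: "\<And>k. k \<in> stencil i \<Longrightarrow> \<bar>v k - w k\<bar> \<le> E"
  shows "\<bar>fd4 h v i - fd4 h w i\<bar> \<le> 3 * E / h"
proof -
  have "\<bar>v (i - 2) - w (i - 2)\<bar> \<le> E" "\<bar>v (i - 1) - w (i - 1)\<bar> \<le> E" "\<bar>v i - w i\<bar> \<le> E"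
    "\<bar>v (i + 1) - w (i + 1)\<bar> \<le> E"
    by (auto intro!: vw simp: stencil_def)
  \<comment> \<open>The absolute weights sum to 56; rounding up to 72 = 3 * 24 leaves the constant 3
    after the division.\<close>
  then have "\<bar>(v (i - 2) - 27 * v (i - 1) + 27 * v i - v (i + 1))
      - (w (i - 2) - 27 * w (i - 1) + 27 * w i - w (i + 1))\<bar> \<le> 72 * E"
    by linarith
  then have "\<bar>fd4 h v i - fd4 h w i\<bar> \<le> 72 * E / (24 * h)"
    unfolding fd4_def diff_divide_distrib[symmetric] abs_divide
    using h by (simp add: field_simps)
  then show ?thesis
    using h by (simp add: field_simps)
qed

section \<open>Cut stencils and the interface\<close>

text \<open>A connected subset of the line is convex, so the segment joining two nodes on opposite
  sides stays in \<open>\<Omega>\<close>. Being connected, it must cross the frontier of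
  \<open>\<Omega>p\<close>, and inside \<open>\<Omega>\<close> that frontier is
  \<open>\<Gamma>\<close>.\<close>

lemma cut_stencil_near_interface:
  assumes sub: "interface_subdivision \<Omega> \<Omega>p \<Omega>m \<Gamma>" and cut: "cut_stencil \<Omega>p \<Omega>m c h i"
    and h: "0 < h"
  obtains g where "g \<in> \<Gamma>" "dist g (cell_center c h i) \<le> 3 * h / 2"
proof -
  obtain k l where k: "k \<in> stencil i" "node c h k \<in> \<Omega>p" and l: "l \<in> stencil i" "node c h l \<in> \<Omega>m"
    using cut unfolding cut_stencil_def by blast
  let ?S = "closed_segment (node c h k) (node c h l)"
  have \<Omega>: "connected \<Omega>" "\<Omega> = \<Omega>p \<union> \<Gamma> \<union> \<Omega>m" "\<Omega>p \<inter> \<Omega>m = {}" "\<Gamma> = \<Omega> \<inter> frontier \<Omega>p"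
    using sub unfolding interface_subdivision_def by blast+
  have "convex \<Omega>"
    using \<Omega>(1) by (simp add: connected_convex_1)
  then have "?S \<subseteq> \<Omega>"
    using k l \<Omega>(2) by (intro closed_segment_subset) auto
  moreover have "?S \<inter> frontier \<Omega>p \<noteq> {}"
    using k l \<Omega>(3) by (intro connected_Int_frontier) auto
  ultimately obtain g where g: "g \<in> \<Gamma>" "g \<in> ?S"
    using \<Omega>(4) by blast
  \<comment> \<open>The outer nodes lie exactly 3h/2 from the center; convexity of the ball takes
    care of the segment.\<close>
  have "node c h j \<in> cball (cell_center c h i) (3 * h / 2)" if "j \<in> stencil i" for j
    using that h
    by (auto simp: stencil_def cball_eq_atLeastAtMost cell_center_eq node_def algebra_simps)
  then have "?S \<subseteq> cball (cell_center c h i) (3 * h / 2)"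
    using k l by (intro closed_segment_subset convex_cball) auto
  with g that show thesis
    by (auto simp: dist_commute)
qed

text \<open>Rules out the default value 0 of \<open>infdist\<close> for the empty set, which would
  make the neighborhood of \<open>\<Gamma>\<close> the whole line.\<close>

lemma interface_nonempty:
  assumes "interface_subdivision \<Omega> \<Omega>p \<Omega>m \<Gamma>"
  shows "\<Gamma> \<noteq> {}"
proof -
  have "\<Omega> \<inter> frontier \<Omega>p \<noteq> {}"
    using assms unfolding interface_subdivision_def
    by (intro connected_Int_frontier) blast+
  then show ?thesis
    using assms unfolding interface_subdivision_def by blast
qed

section \<open>The error estimate for centers in one subdomain\<close>

lemma corrected_fd4_order_plus:
  fixes Dh :: "real \<Rightarrow> int \<Rightarrow> real"
  assumes sub: "interface_subdivision \<Omega> \<Omega>p \<Omega>m \<Gamma>"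
    and A_plus: "\<And>x. x \<in> \<Omega>p \<Longrightarrow> A x = Ap x"
    and A_minus: "\<And>x. x \<in> \<Omega>m \<Longrightarrow> A x = Am x"
    and ext: "\<Gamma> \<subseteq> Up" "Ck_on 5 Ap Up"
    and D_accuracy:
      "uniform_bigo (\<lambda>h k. correction_node \<Omega>p \<Omega>m (c h) h k)
         (\<lambda>h k. correction_function Ap Am (node (c h) h k) - Dh h k)
         (\<lambda>h. h ^ p)"
  shows "uniform_bigo
           (\<lambda>h i. cell_center (c h) h i \<in> \<Omega>p \<and> cut_stencil \<Omega>p \<Omega>m (c h) h i)
           (\<lambda>h i. corrected_fd4 \<Omega>p \<Omega>m A (c h) h (Dh h) i - deriv Ap (cell_center (c h) h i))
           (\<lambda>h. h powi (min (int p - 1) 4))"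
proof -
  have \<Gamma>: "compact \<Gamma>" "\<Gamma> \<noteq> {}" and disj: "\<Omega>p \<inter> \<Omega>m = {}"
    using sub interface_nonempty[OF sub] unfolding interface_subdivision_def by blast+
  have Up: "open Up" "continuous_on Up ((deriv ^^ 5) Ap)"
    using ext(2) by (auto simp: Ck_on_def)
  \<comment> \<open>The closed \<open>e\<close>-neighborhood of \<open>\<Gamma>\<close> is compact,
    so \<open>M\<close> bounds the fifth derivative independently of \<open>h\<close>, of the index
    and of the grid offset \<open>c h\<close>.\<close>
  obtain e where e: "0 < e" "{x. infdist x \<Gamma> \<le> e} \<subseteq> Up"
    using compact_in_open_separated[OF \<Gamma>(2,1) Up(1) ext(1)] by auto
  let ?K = "{x. infdist x \<Gamma> \<le> e}"
  have "compact ((deriv ^^ 5) Ap ` ?K)"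
    using compact_infdist_le[OF \<Gamma>(2,1) e(1)] continuous_on_subset[OF Up(2) e(2)]
    by (intro compact_continuous_image)
  then obtain M where M: "\<And>t. t \<in> ?K \<Longrightarrow> \<bar>(deriv ^^ 5) Ap t\<bar> \<le> M"
    using compact_imp_bounded bounded_iff
    by (metis (no_types, lifting) imageI real_norm_def)
  obtain C where C: "\<forall>\<^sub>F h in at_right 0. \<forall>k. correction_node \<Omega>p \<Omega>m (c h) h k \<longrightarrow>
      \<bar>correction_function Ap Am (node (c h) h k) - Dh h k\<bar> \<le> C * \<bar>h ^ p\<bar>"
    using D_accuracy unfolding uniform_bigo_def by blast
  \<comment> \<open>Below 1, lowering the exponent enlarges the power, so both error terms are
    absorbed by exponent \<open>q\<close>. Below \<open>e / 3\<close>, the ball of radius 3h/2 about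
    a center at distance at most 3h/2 from \<open>\<Gamma>\<close> stays in the
    \<open>e\<close>-neighborhood.\<close>
  have small: "\<forall>\<^sub>F h in at_right 0. 0 < h \<and> h < min 1 (e / 3)"
    using e(1)
    by (intro eventually_conj eventually_at_right_less eventually_at_rightI[of 0 "min 1 (e / 3)"])
      auto
  \<comment> \<open>An integer exponent: for p = 0 it is -1, the rate left after dividing by
    \<open>h\<close>.\<close>
  define q where "q = min (int p - 1) 4"
  have "\<forall>\<^sub>F h in at_right 0. \<forall>i. cell_center (c h) h i \<in> \<Omega>p \<and> cut_stencil \<Omega>p \<Omega>m (c h) h i \<longrightarrow>
     \<bar>corrected_fd4 \<Omega>p \<Omega>m A (c h) h (Dh h) i - deriv Ap (cell_center (c h) h i)\<bar>
       \<le> (\<bar>M\<bar> + 3 * \<bar>C\<bar>) * \<bar>h powi q\<bar>"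
    using C small
  proof eventually_elim
    case (elim h)
    then have h: "0 < h" "h < 1" "3 * h < e" by auto
    show ?case
    proof (intro allI impI, elim conjE)
      fix i
      assume i: "cell_center (c h) h i \<in> \<Omega>p" and cut: "cut_stencil \<Omega>p \<Omega>m (c h) h i"
      let ?y = "cell_center (c h) h i"
      obtain g where g: "g \<in> \<Gamma>" "dist g ?y \<le> 3 * h / 2"
        using cut_stencil_near_interface[OF sub cut h(1)] .
      have K: "cball ?y (3 * h / 2) \<subseteq> ?K"
      proof
        fix t assume "t \<in> cball ?y (3 * h / 2)"
        then have "dist t g \<le> e"
          using g(2) h(3) dist_triangle[of t g ?y] by (simp add: dist_commute)
        then show "t \<in> ?K"
          using infdist_le[OF g(1), of t] by simp
      qed
      have "\<bar>fd4 h (\<lambda>k. Ap (node (c h) h k)) i - deriv Ap ?y\<bar> \<le> M * h ^ 4"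
        using K e(2) M by (intro fd4_consistency[OF h(1) ext(2)]) auto
      also have "\<dots> \<le> \<bar>M\<bar> * h ^ 4"
        using h by (intro mult_right_mono) auto
      also have "h ^ 4 = h powi 4"
        by simp
      also have "\<dots> \<le> h powi q"
        using h by (intro power_int_decreasing) (auto simp: q_def)
      finally have 1: "\<bar>fd4 h (\<lambda>k. Ap (node (c h) h k)) i - deriv Ap ?y\<bar> \<le> \<bar>M\<bar> * h powi q"
        by (simp add: mult_left_mono)
      \<comment> \<open>At a node in \<open>\<Omega>m\<close>, Am + d - Ap = -(D - d) is the
        correction error up to sign; at a node in \<open>\<Omega>p\<close> the value used is
        exact.\<close>
      have "\<bar>corrected_value \<Omega>p \<Omega>m A (c h) h (Dh h) i k - Ap (node (c h) h k)\<bar> \<le> \<bar>C\<bar> * h ^ p"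
        if k: "k \<in> stencil i" for k
      proof (cases "node (c h) h k \<in> \<Omega>m")
        case True
        then have "correction_node \<Omega>p \<Omega>m (c h) h k"
          using cut i k unfolding correction_node_def by blast
        then have "\<bar>correction_function Ap Am (node (c h) h k) - Dh h k\<bar> \<le> C * h ^ p"
          using elim(1) h by auto
        also have "\<dots> \<le> \<bar>C\<bar> * h ^ p"
          using h by (intro mult_right_mono) auto
        finally show ?thesis
          using True i A_minus by (simp add: corrected_value_def correction_function_def)
      next
        case False
        then have "node (c h) h k \<in> \<Omega>p"
          using cut k unfolding cut_stencil_def by blast
        then show ?thesis
          using False i A_plus disj h by (auto simp: corrected_value_def)
      qed
      then have "\<bar>corrected_fd4 \<Omega>p \<Omega>m A (c h) h (Dh h) i - fd4 h (\<lambda>k. Ap (node (c h) h k)) i\<bar>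
          \<le> 3 * (\<bar>C\<bar> * h ^ p) / h"
        unfolding corrected_fd4_def by (intro fd4_perturbation h)
      also have "\<dots> = 3 * \<bar>C\<bar> * h powi (int p - 1)"
        using h by (simp add: power_int_diff)
      also have "\<dots> \<le> 3 * \<bar>C\<bar> * h powi q"
        using h by (intro mult_left_mono power_int_decreasing) (auto simp: q_def)
      finally have 2: "\<bar>corrected_fd4 \<Omega>p \<Omega>m A (c h) h (Dh h) i - fd4 h (\<lambda>k. Ap (node (c h) h k)) i\<bar>
          \<le> 3 * \<bar>C\<bar> * h powi q" .
      show "\<bar>corrected_fd4 \<Omega>p \<Omega>m A (c h) h (Dh h) i - deriv Ap ?y\<bar>
          \<le> (\<bar>M\<bar> + 3 * \<bar>C\<bar>) * \<bar>h powi q\<bar>"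
        using 1 2 h by (simp add: distrib_right)
    qed
  qed
  then show ?thesis
    unfolding uniform_bigo_def q_def by blast
qed

section \<open>Exchange of the two subdomains\<close>

lemma interface_subdivision_swap:
  "interface_subdivision \<Omega> \<Omega>p \<Omega>m \<Gamma> \<Longrightarrow> interface_subdivision \<Omega> \<Omega>m \<Omega>p \<Gamma>"
  unfolding interface_subdivision_def by blast

lemma cut_stencil_swap: "cut_stencil \<Omega>m \<Omega>p = cut_stencil \<Omega>p \<Omega>m"
  by (auto simp: cut_stencil_def fun_eq_iff)

lemma correction_node_swap: "correction_node \<Omega>m \<Omega>p = correction_node \<Omega>p \<Omega>m"
  by (auto simp: correction_node_def cut_stencil_swap[of \<Omega>m \<Omega>p] fun_eq_iff)

text \<open>Adding -d is subtracting d, so the two correcting branches trade places. Disjointness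
  makes them exclusive, so their order does not matter.\<close>

lemma corrected_fd4_swap:
  assumes "\<Omega>p \<inter> \<Omega>m = {}"
  shows "corrected_fd4 \<Omega>m \<Omega>p A c h (\<lambda>k. - d k) i = corrected_fd4 \<Omega>p \<Omega>m A c h d i"
proof -
  have "corrected_value \<Omega>m \<Omega>p A c h (\<lambda>k. - d k) i = corrected_value \<Omega>p \<Omega>m A c h d i"
    using assms by (auto simp: corrected_value_def fun_eq_iff)
  then show ?thesis
    by (simp add: corrected_fd4_def)
qed

theorem lemma4p1:
  fixes \<Omega> \<Omega>p \<Omega>m \<Gamma> Up Um :: "real set"
    and A Ap Am :: "real \<Rightarrow> real"
    and c :: "real \<Rightarrow> real"
    and Dh :: "real \<Rightarrow> int \<Rightarrow> real"
    and p :: nat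
  assumes subdivision: "interface_subdivision \<Omega> \<Omega>p \<Omega>m \<Gamma>"
    and A_plus: "\<And>x. x \<in> \<Omega>p \<Longrightarrow> A x = Ap x"
    and A_minus: "\<And>x. x \<in> \<Omega>m \<Longrightarrow> A x = Am x"
    and extension_plus: "\<Omega>p \<union> \<Gamma> \<subseteq> Up" "Ck_on 5 Ap Up"
    and extension_minus: "\<Omega>m \<union> \<Gamma> \<subseteq> Um" "Ck_on 5 Am Um"
    and D_accuracy:
      "uniform_bigo (\<lambda>h k. correction_node \<Omega>p \<Omega>m (c h) h k)
         (\<lambda>h k. correction_function Ap Am (node (c h) h k) - Dh h k)
         (\<lambda>h. h ^ p)"
  shows "uniform_bigo
           (\<lambda>h i. cell_center (c h) h i \<in> \<Omega>p \<and> cut_stencil \<Omega>p \<Omega>m (c h) h i)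
           (\<lambda>h i. corrected_fd4 \<Omega>p \<Omega>m A (c h) h (Dh h) i - deriv Ap (cell_center (c h) h i))
           (\<lambda>h. h powi (min (int p - 1) 4))
       \<and> uniform_bigo
           (\<lambda>h i. cell_center (c h) h i \<in> \<Omega>m \<and> cut_stencil \<Omega>p \<Omega>m (c h) h i)
           (\<lambda>h i. corrected_fd4 \<Omega>p \<Omega>m A (c h) h (Dh h) i - deriv Am (cell_center (c h) h i))
           (\<lambda>h. h powi (min (int p - 1) 4))"
proof
  show "uniform_bigo
      (\<lambda>h i. cell_center (c h) h i \<in> \<Omega>p \<and> cut_stencil \<Omega>p \<Omega>m (c h) h i)
      (\<lambda>h i. corrected_fd4 \<Omega>p \<Omega>m A (c h) h (Dh h) i - deriv Ap (cell_center (c h) h i))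
      (\<lambda>h. h powi (min (int p - 1) 4))"
    using corrected_fd4_order_plus[OF subdivision A_plus A_minus _ extension_plus(2) D_accuracy]
      extension_plus(1) by simp
next
  have disj: "\<Omega>p \<inter> \<Omega>m = {}"
    using subdivision by (simp add: interface_subdivision_def)
  \<comment> \<open>The exchange negates both D and its approximation, so the accuracy hypothesis
    carries over with the same constant.\<close>
  have "\<bar>correction_function Am Ap x - - d\<bar> = \<bar>correction_function Ap Am x - d\<bar>" for x d
    by (simp add: correction_function_def)
  then have "uniform_bigo (\<lambda>h k. correction_node \<Omega>m \<Omega>p (c h) h k)
      (\<lambda>h k. correction_function Am Ap (node (c h) h k) - - Dh h k) (\<lambda>h. h ^ p)"
    using D_accuracy by (simp only: uniform_bigo_def correction_node_swap[of \<Omega>m \<Omega>p])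
  from corrected_fd4_order_plus[OF interface_subdivision_swap[OF subdivision] A_minus A_plus _
      extension_minus(2) this]
  show "uniform_bigo
      (\<lambda>h i. cell_center (c h) h i \<in> \<Omega>m \<and> cut_stencil \<Omega>p \<Omega>m (c h) h i)
      (\<lambda>h i. corrected_fd4 \<Omega>p \<Omega>m A (c h) h (Dh h) i - deriv Am (cell_center (c h) h i))
      (\<lambda>h. h powi (min (int p - 1) 4))"
    using extension_minus(1)
    by (simp add: cut_stencil_swap[of \<Omega>m \<Omega>p] corrected_fd4_swap[OF disj])
qed

end
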